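(* Let $n\ge 1$, let $(S_i,\mathbb{S}_i)$, $i=1,\ldots,n$, be measurable spaces, $S=\prod_{i=1}^n S_i$, $\mathbb{S}=\bigotimes_{i=1}^n\mathbb{S}_i$, and let $\mathbf{X}=(X_1,\ldots,X_n)\in S$ be a random vector with distribution $P$, a probability measure on $(S,\mathbb{S})$ under which $X_1,\ldots,X_n$ are independent. (a) Let $\mathcal{A},\mathcal{B}$ be finite or countable index sets, and let $\{f_\alpha\}_{\alpha\in\mathcal{A}}$ and $\{g_\beta\}_{\beta\in\mathcal{B}}$ be collections of non-negative real-valued $\mathbb{S}$-measurable functions on $S$ such that $f_\alpha$ depends on $K_\alpha\subseteq\mathbf{n}$ for each $\alpha\in\mathcal A$ and $g_\beta$ depends on $L_\beta\subseteq\mathbf{n}$ for each $\beta\in\mathcal B$. Then $$E\Big\{\sup_{\alpha\in\mathcal{A},\,\beta\in\mathcal{B}:\ K_\alpha\cap L_\beta=\emptyset} f_\alpha(\mathbf{X})g_\beta(\mathbf{X})\Big\}\le E\Big\{\sup_{\alpha\in\mathcal{A}} f_\alpha(\mathbf{X})\Big\}\,E\Big\{\sup_{\beta\in\mathcal{B}} g_\beta(\mathbf{X})\Big\}.$$ (b) Let $f$ and $g$ be non-negative real-valued $\mathbb{S}$-measurable functions on $S$ and let $\mathcal{K},\mathcal{L}\subseteq 2^{\mathbf{n}}$ be any collections of subsets of $\mathbf{n}$. Then $$E\Big\{\max_{K\in\mathcal{K},\,L\in\mathcal{L}:\ K\cap L=\emptyset}\underline{f}_K(\mathbf{X})\,\underline{g}_L(\mathbf{X})\Big\}\le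 E\{f(\mathbf{X})\}\,E\{g(\mathbf{X})\}.$$
   Context: $\mathbf{n}=\{1,\ldots,n\}$. For $\mathbf{x}\in S$ and $K\subseteq\mathbf{n}$, $\mathbf{x}_K$ is the restriction of $\mathbf{x}$ to the coordinates in $K$, and $[\mathbf{x}]_K=\{\mathbf{y}\in S:\mathbf{y}_K=\mathbf{x}_K\}$. A function $f$ on $S$ depends on $K$ if $\mathbf{x}_K=\mathbf{y}_K$ implies $f(\mathbf{x})=f(\mathbf{y})$. The sets $K_\alpha$ (and likewise the $L_\beta$) need not be distinct. For a non-negative measurable $f$ and $K\subseteq\mathbf{n}$, $\underline{f}_K(\mathbf{x})=\operatorname{ess\,inf}_{\mathbf{y}\in[\mathbf{x}]_K}f(\mathbf{y})$, where the essential infimum is taken over the coordinates of $\mathbf{y}$ in $K^c$, with respect to the marginal $P_{K^c}$ of $P$ on those coordinates (the coordinates in $K$ being fixed equal to $\mathbf{x}_K$); $\underline{g}_L$ is defined in the same way. For $K=\mathbf{n}$, $\underline{f}_K=f$. Expectations take values in $[0,\infty]$, $0\cdot\infty=0$, and the supremum (maximum) of an empty collection of non-negative quantities is $0$. *)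

theory Defs
  imports "HOL-Probability.Probability"
begin

definition depends_on :: "('i \<Rightarrow> 'a) set \<Rightarrow> 'i set \<Rightarrow> (('i \<Rightarrow> 'a) \<Rightarrow> 'b) \<Rightarrow> bool" where
  "depends_on D K f \<longleftrightarrow> (\<forall>x\<in>D. \<forall>y\<in>D. restrict x K = restrict y K \<longrightarrow> f x = f y)"

definition marginal :: "('i \<Rightarrow> 'a measure) \<Rightarrow> 'i set \<Rightarrow> ('i \<Rightarrow> 'a) measure \<Rightarrow> ('i \<Rightarrow> 'a) measure" where
  "marginal S J P = distr P (Pi\<^sub>M J S) (\<lambda>x. restrict x J)"

(* Analogue of the library's esssup, for functions with values in [0, \<infinity>].
   The set on the right always contains 0. *)
definition ess_inf :: "'a measure \<Rightarrow> ('a \<Rightarrow> ennreal) \<Rightarrow> ennreal" where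
  "ess_inf M f = Sup {c. AE y in M. c \<le> f y}"

(* The coordinates in K are fixed to those of x, the coordinates in I - K are drawn from
   the marginal of P; a point of the product over I is assembled from the two by merge. *)
definition ess_inf_cyl ::
    "('i \<Rightarrow> 'a measure) \<Rightarrow> 'i set \<Rightarrow> ('i \<Rightarrow> 'a) measure \<Rightarrow> (('i \<Rightarrow> 'a) \<Rightarrow> real) \<Rightarrow> 'i set \<Rightarrow> ('i \<Rightarrow> 'a) \<Rightarrow> ennreal" where
  "ess_inf_cyl S I P f K x =
     ess_inf (marginal S (I - K) P) (\<lambda>y. ennreal (f (merge K (I - K) (x, y))))"

end

theory Submission
  imports Defs "HOL-Computational_Algebra.Polynomial"
begin

text \<open>
  The inequality is a functional form of the van den Berg--Kesten--Reimer inequality, and the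
  proof reduces it, with no discretisation of the state spaces, to Reimer's counting theorem on
  the subsets of a finite set \<open>V\<close>.

  \<^emph>\<open>The counting theorem\<close> (\<open>reimer_butterfly\<close>). Give every \<open>x\<close> in a family \<open>T\<close> of subsets of \<open>V\<close>
  a set \<open>C x\<close>; if \<open>A\<close> contains whatever agrees with some \<open>x\<close> on \<open>C x\<close>, and \<open>B\<close> whatever agrees with
  some \<open>x\<close> off \<open>C x\<close>, then at least \<open>card T\<close> sets lie in \<open>A\<close> and have their complement in \<open>B\<close>. The
  proof is linear algebra over polynomials in \<open>t\<close>. The space of functions on the subsets of \<open>V\<close> is
  a tensor power of a plane, in which the bases \<open>(1, 0), (0, 1)\<close> and \<open>(1, t), (t, 1)\<close> are
  used side by side. The vector \<open>w x\<close> that takes the first basis on \<open>C x\<close> and the second one off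
  \<open>C x\<close> is supported in \<open>A\<close> and is a combination of second-basis vectors indexed by \<open>B\<close>. If the theorem
  failed, the \<open>w x\<close> would outnumber the equations, and some nontrivial combination of them would vanish at every index whose
  complement is in \<open>B\<close>. For \<open>t\<close> near infinity a second-basis vector is dominated by its entry at
  the complementary index, so this combination vanishes identically; for \<open>t\<close> near \<open>0\<close> the vectors
  \<open>w x\<close> are close to unit vectors, so they are independent, a contradiction. Comparing
  top and bottom coefficients makes both limits precise.

  \<^emph>\<open>From sets to functions\<close> (\<open>weighted_butterfly\<close>). A nonnegative number is the length of the set of levels
  below it, so a product of two such numbers is a double integral over pairs of levels, and for each
  pair the counting theorem applies.

  \<^emph>\<open>From counting to product measures\<close> (\<open>disjoint_cylinder_product_inequality\<close>). Take independent
  copies \<open>x\<close> and \<open>y\<close> of the random vector. For a set \<open>z\<close> of coordinates, replace the coordinates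
  of \<open>x\<close> in \<open>z\<close> by those of \<open>y\<close>; the complementary exchange is then a vector independent of this one,
  and both have the original law. For fixed \<open>x\<close> and \<open>y\<close> everything is a function of \<open>z\<close>,
  the weighted counting theorem bounds the sum over \<open>z\<close>, and integration over \<open>x\<close> and \<open>y\<close> gives
  part (a).

  \<^emph>\<open>Essential infima.\<close> The essential infimum over the coordinates outside \<open>K\<close> is bounded by a
  measurable function depending only on \<open>K\<close> which is almost surely at most the original function,
  so part (b) is an instance of part (a) for finitely many functions.
\<close>

section \<open>Linear algebra over an integral domain\<close>

text \<open>
  Gaussian elimination without division: one unknown with a nonzero coefficient in the equation
  \<open>e\<close> is removed from the other equations by cross-multiplication, and its value is recovered
  at the end after scaling the other unknowns by that coefficient.
\<close>

lemma homogeneous_system_nontrivial_solution: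
  fixes m :: "'e \<Rightarrow> 'x \<Rightarrow> 'k::idom"
  assumes "finite E" "finite T" "card E < card T"
  shows "\<exists>c. (\<exists>x\<in>T. c x \<noteq> 0) \<and> (\<forall>e\<in>E. (\<Sum>x\<in>T. c x * m e x) = 0)"
  using assms
proof (induction E arbitrary: T m rule: finite_induct)
  case empty
  then obtain x where "x \<in> T" by (cases "T = {}") auto
  then show ?case by (intro exI[of _ "\<lambda>_. 1"]) auto
next
  case (insert e E)
  show ?case
  proof (cases "\<forall>x\<in>T. m e x = 0")
    case True
    have "card E < card T" using insert by simp
    then obtain c where c: "\<exists>x\<in>T. c x \<noteq> 0" "\<forall>e\<in>E. (\<Sum>x\<in>T. c x * m e x) = 0"
      using insert.IH[of T m] insert.prems by blast
    have "(\<Sum>x\<in>T. c x * m e x) = 0" using True by simp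
    with c show ?thesis by blast
  next
    case False
    then obtain x0 where x0: "x0 \<in> T" and p: "m e x0 \<noteq> 0" by blast
    let ?T = "T - {x0}"
    let ?m = "\<lambda>e' x. m e x0 * m e' x - m e' x0 * m e x"
    have "card E < card ?T" using insert x0 by simp
    then obtain d where d: "\<exists>x\<in>?T. d x \<noteq> 0" "\<forall>e'\<in>E. (\<Sum>x\<in>?T. d x * ?m e' x) = 0"
      using insert.IH[of ?T ?m] insert.prems by blast
    define c where "c x = (if x = x0 then - (\<Sum>x\<in>?T. d x * m e x) else m e x0 * d x)" for x
    have nz: "\<exists>x\<in>T. c x \<noteq> 0" using d(1) p by (auto simp: c_def)
    have split: "(\<Sum>x\<in>T. c x * m e' x) = (\<Sum>x\<in>?T. d x * ?m e' x)" for e'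
    proof -
      have "(\<Sum>x\<in>T. c x * m e' x) = c x0 * m e' x0 + (\<Sum>x\<in>?T. c x * m e' x)"
        using x0 insert.prems by (simp add: sum.remove)
      also have "(\<Sum>x\<in>?T. c x * m e' x) = (\<Sum>x\<in>?T. m e x0 * d x * m e' x)"
        by (intro sum.cong) (auto simp: c_def)
      also have "c x0 * m e' x0 + \<dots> = (\<Sum>x\<in>?T. d x * ?m e' x)"
        by (simp add: c_def sum_distrib_right sum_subtractf right_diff_distrib sum_distrib_left mult_ac)
      finally show ?thesis .
    qed
    have "(\<Sum>x\<in>T. c x * m e x) = 0" unfolding split by (simp add: mult.commute)
    with split d(2) nz show ?thesis by auto
  qed
qed

section \<open>Reimer's counting theorem\<close>

text \<open>
  The one-coordinate identities \<open>1 - t * t = 1 - t\<^sup>2\<close> and \<open>t - t * 1 = 0\<close>, multiplied over the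
  coordinates in \<open>C\<close>: they express that \<open>(1, t) - t (t, 1)\<close> is \<open>1 - t\<^sup>2\<close> times a unit vector.
\<close>

lemma signed_subcube_sum:
  fixes t :: "'k::comm_ring_1"
  assumes "finite C" "finite u"
  shows "(\<Sum>D\<in>Pow C. (- t) ^ card D * t ^ card (sym_diff u D))
       = (if u \<inter> C = {} then (1 - t\<^sup>2) ^ card C * t ^ card u else 0)"
  using assms(1)
proof (induction C rule: finite_induct)
  case empty then show ?case by simp
next
  case (insert i C)
  let ?F = "\<lambda>D. (- t) ^ card D * t ^ card (sym_diff u D)"
  have fD: "finite D" if "D \<in> Pow C" for D using that insert.hyps finite_subset by auto
  have "(\<Sum>D\<in>Pow (insert i C). ?F D) = (\<Sum>D\<in>Pow C. ?F D) + (\<Sum>D\<in>insert i ` Pow C. ?F D)"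
    unfolding Pow_insert by (rule sum.union_disjoint) (use insert.hyps in auto)
  also have "(\<Sum>D\<in>insert i ` Pow C. ?F D) = (\<Sum>D\<in>Pow C. ?F (insert i D))"
    by (subst sum.reindex) (use insert.hyps in \<open>auto simp: inj_on_def\<close>)
  also have "\<dots> = (\<Sum>D\<in>Pow C. (if i \<in> u then - 1 else - t\<^sup>2) * ?F D)"
  proof (rule sum.cong[OF refl])
    fix D assume D: "D \<in> Pow C"
    have i: "i \<notin> D" using D insert.hyps by auto
    show "?F (insert i D) = (if i \<in> u then - 1 else - t\<^sup>2) * ?F D"
    proof (cases "i \<in> u")
      case True
      have "sym_diff u D = insert i (sym_diff u (insert i D))" using True i by auto
      moreover have "i \<notin> sym_diff u (insert i D)" using True by auto
      ultimately have "card (sym_diff u D) = Suc (card (sym_diff u (insert i D)))"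
        using fD[OF D] assms(2) by (simp del: insert_Diff_single)
      then show ?thesis using True i fD[OF D] by simp
    next
      case False
      have "sym_diff u (insert i D) = insert i (sym_diff u D)" using False i by auto
      moreover have "i \<notin> sym_diff u D" using False i by auto
      ultimately have "card (sym_diff u (insert i D)) = Suc (card (sym_diff u D))"
        using fD[OF D] assms(2) by simp
      then show ?thesis using False i fD[OF D] by (simp add: power2_eq_square)
    qed
  qed
  finally show ?case
    using insert by (simp add: sum_distrib_left[symmetric] sum_negf algebra_simps)
qed

text \<open>
  The matrix with entries \<open>t ^ card (sym_diff y (V - z))\<close> has \<open>t ^ card V\<close>, its largest possible
  power, exactly on the diagonal. Hence every principal submatrix is nonsingular: if \<open>\<gamma> z\<close> has the
  greatest degree, nothing can cancel its top term in the row of \<open>z\<close>.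
\<close>

lemma top_coefficients_force_zero:
  fixes \<gamma> :: "'v set \<Rightarrow> 'k::idom poly"
  assumes V: "finite V" and B: "B \<subseteq> Pow V"
    and zero: "\<And>z. z \<in> B \<Longrightarrow> (\<Sum>y\<in>B. \<gamma> y * monom 1 (card (sym_diff y (V - z)))) = 0"
    and "y \<in> B"
  shows "\<gamma> y = 0"
proof (rule ccontr)
  assume "\<gamma> y \<noteq> 0"
  have fB: "finite B" using V B finite_subset by auto
  define B' where "B' = {y \<in> B. \<gamma> y \<noteq> 0}"
  have B': "finite B'" "B' \<noteq> {}" using fB \<open>y \<in> B\<close> \<open>\<gamma> y \<noteq> 0\<close> by (auto simp: B'_def)
  define d where "d = Max ((\<lambda>y. degree (\<gamma> y)) ` B')"
  obtain z where z: "z \<in> B'" "degree (\<gamma> z) = d"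
    using Max_in[of "(\<lambda>y. degree (\<gamma> y)) ` B'"] B' unfolding d_def by fastforce
  have zB: "z \<in> B" using z by (simp add: B'_def)
  have le: "degree (\<gamma> y) \<le> d" if "y \<in> B" for y
    using that B' by (cases "\<gamma> y = 0") (auto simp: d_def B'_def intro!: Max_ge)
  have "coeff (\<Sum>y\<in>B. \<gamma> y * monom 1 (card (sym_diff y (V - z)))) (d + card V)
      = (\<Sum>y\<in>B. if y = z then coeff (\<gamma> z) d else 0)"
    unfolding coeff_sum
  proof (rule sum.cong[OF refl])
    fix y assume y: "y \<in> B"
    have yz: "y \<subseteq> V" "z \<subseteq> V" using y zB B by auto
    have "sym_diff y (V - z) = V - sym_diff y z" using yz by auto
    then have c: "card (sym_diff y (V - z)) = card V - card (sym_diff y z)"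
      using V yz by (simp only:) (intro card_Diff_subset, auto intro: finite_subset)
    have le': "card (sym_diff y z) \<le> card V" using V yz by (intro card_mono) auto
    have fin: "finite (sym_diff y z)" using V yz by (auto intro: finite_subset)
    have "coeff (\<gamma> y * monom 1 (card (sym_diff y (V - z)))) (d + card V)
        = coeff (\<gamma> y) (d + card (sym_diff y z))"
      unfolding c using le' by (subst mult.commute) (simp add: coeff_monom_mult)
    also have "\<dots> = (if y = z then coeff (\<gamma> z) d else 0)"
    proof (cases "y = z")
      case False
      then have "card (sym_diff y z) > 0" using fin by (auto simp: card_gt_0_iff)
      then show ?thesis using le[OF y] False by (simp add: coeff_eq_0)
    qed simp
    finally show "coeff (\<gamma> y * monom 1 (card (sym_diff y (V - z)))) (d + card V)
        = (if y = z then coeff (\<gamma> z) d else 0)" .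
  qed
  also have "\<dots> = coeff (\<gamma> z) d" using fB zB by simp
  finally show False using zero[OF zB] z by (auto simp: B'_def)
qed

text \<open>
  At \<open>t = 0\<close> the matrix \<open>w\<close> is the identity, so nothing can cancel the lowest power of \<open>t\<close> that
  occurs among the coefficients \<open>c\<close>.
\<close>

lemma bottom_coefficients_force_zero:
  fixes c :: "'x \<Rightarrow> 'k::idom poly"
  assumes T: "finite T"
    and w0: "\<And>x z. x \<in> T \<Longrightarrow> z \<in> T \<Longrightarrow> coeff (w x z) 0 = (if x = z then 1 else 0)"
    and zero: "\<And>z. z \<in> T \<Longrightarrow> (\<Sum>x\<in>T. c x * w x z) = 0"
    and "x \<in> T"
  shows "c x = 0"
proof (rule ccontr)
  assume "c x \<noteq> 0"
  then have ex: "\<exists>k. \<exists>x\<in>T. coeff (c x) k \<noteq> 0" using \<open>x \<in> T\<close> by (auto simp: poly_eq_iff)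
  define k where "k = (LEAST k. \<exists>x\<in>T. coeff (c x) k \<noteq> 0)"
  obtain z where z: "z \<in> T" "coeff (c z) k \<noteq> 0" using LeastI_ex[OF ex] unfolding k_def by blast
  have low: "coeff (c x) j = 0" if "x \<in> T" "j < k" for x j
    using not_less_Least[OF that(2)[unfolded k_def]] that(1) by blast
  have "coeff (\<Sum>x\<in>T. c x * w x z) k = (\<Sum>x\<in>T. if x = z then coeff (c z) k else 0)"
    unfolding coeff_sum
  proof (rule sum.cong[OF refl])
    fix x assume x: "x \<in> T"
    have "coeff (c x * w x z) k = (\<Sum>j\<le>k. coeff (c x) j * coeff (w x z) (k - j))"
      by (rule coeff_mult)
    also have "\<dots> = (\<Sum>j\<le>k. if j = k then coeff (c x) k * coeff (w x z) 0 else 0)"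
      by (intro sum.cong) (auto simp: low[OF x])
    also have "\<dots> = (if x = z then coeff (c z) k else 0)" using w0[OF x z(1)] by simp
    finally show "coeff (c x * w x z) k = (if x = z then coeff (c z) k else 0)" .
  qed
  also have "\<dots> = coeff (c z) k" using T z by simp
  finally show False using zero[OF z(1)] z(2) by simp
qed

text \<open>
  Subsets of \<open>V\<close> stand for binary strings: \<open>x\<close> and \<open>z\<close> agree on \<open>C x\<close> if their symmetric difference
  misses \<open>C x\<close>, and off \<open>C x\<close> if it lies inside \<open>C x\<close>. The strings that agree with \<open>x\<close>
  on \<open>C x\<close> and those that agree with it off \<open>C x\<close> form the two wings of the butterfly with body \<open>x\<close>.
  In the linear algebra of the introduction, the second-basis vector of index \<open>y\<close> is
  \<open>z \<mapsto> t ^ card (sym_diff y z)\<close>, and a change of basis on the coordinates in \<open>C x\<close> places \<open>w x\<close> in the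
  span of the vectors indexed by the second wing.
\<close>

lemma reimer_butterfly:
  fixes V :: "'v set"
  assumes V: "finite V" and T: "T \<subseteq> Pow V"
    and C: "\<And>x. x \<in> T \<Longrightarrow> C x \<subseteq> V"
    and A: "\<And>x z. x \<in> T \<Longrightarrow> z \<subseteq> V \<Longrightarrow> sym_diff x z \<inter> C x = {} \<Longrightarrow> z \<in> A"
    and B: "\<And>x z. x \<in> T \<Longrightarrow> z \<subseteq> V \<Longrightarrow> sym_diff x z \<subseteq> C x \<Longrightarrow> z \<in> B"
  shows "card T \<le> card {z \<in> Pow V. z \<in> A \<and> V - z \<in> B}"
proof (rule ccontr)
  let ?E = "{z \<in> Pow V. z \<in> A \<and> V - z \<in> B}"
  let ?B = "B \<inter> Pow V"
  assume "\<not> card T \<le> card ?E"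
  then have less: "card ?E < card T" by simp
  have fT: "finite T" and fE: "finite ?E" and fB: "finite ?B" 
    using V T finite_subset by (auto intro: finite_subset[of _ "Pow V"])
  define t :: "int poly" where "t = monom 1 1"
  have tpow: "t ^ k = monom 1 k" for k by (simp add: t_def monom_power)
  \<comment> \<open>The factor \<open>1 - t\<^sup>2\<close> for each coordinate in \<open>C x\<close> clears the denominators of the change of basis.\<close>
  define w where "w x z = (if sym_diff x z \<inter> C x = {}
    then (1 - t\<^sup>2) ^ card (C x) * t ^ card (sym_diff x z) else 0)" for x z
  obtain c where c: "\<exists>x\<in>T. c x \<noteq> 0" "\<And>z. z \<in> ?E \<Longrightarrow> (\<Sum>x\<in>T. c x * w x z) = 0"
    using homogeneous_system_nontrivial_solution[OF fE fT less, of "\<lambda>z x. w x z"] by blast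
  \<comment> \<open>\<open>\<gamma>\<close> lists the coordinates of the vanishing combination in the second basis.\<close>
  define \<gamma> where "\<gamma> y = (\<Sum>x\<in>T. if sym_diff x y \<subseteq> C x then c x * (- t) ^ card (sym_diff x y) else 0)" for y
  have w_expand: "w x z = (\<Sum>y\<in>?B. if sym_diff x y \<subseteq> C x
      then (- t) ^ card (sym_diff x y) * t ^ card (sym_diff y z) else 0)"
    if x: "x \<in> T" and z: "z \<subseteq> V" for x z
  proof -
    have "finite x" "finite z" using V x z T by (auto intro: finite_subset)
    then have fin: "finite (C x)" "finite (sym_diff x z)"
      using V C[OF x] by (auto intro: finite_subset)
    have "w x z = (\<Sum>D\<in>Pow (C x). (- t) ^ card D * t ^ card (sym_diff (sym_diff x z) D))"
      unfolding w_def signed_subcube_sum[OF fin] ..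
    also have "\<dots> = (\<Sum>y\<in>{y\<in>?B. sym_diff x y \<subseteq> C x}.
        (- t) ^ card (sym_diff x y) * t ^ card (sym_diff y z))"
    proof (rule sum.reindex_bij_witness[of _ "\<lambda>y. sym_diff x y" "\<lambda>D. sym_diff x D"])
      fix D assume D: "D \<in> Pow (C x)"
      have eq: "sym_diff x (sym_diff x D) = D" by auto
      have "sym_diff x D \<subseteq> V" using D C[OF x] x T by auto
      moreover have "sym_diff x D \<in> B" by (rule B[OF x]) (use calculation D eq in auto)
      ultimately show "sym_diff x D \<in> {y\<in>?B. sym_diff x y \<subseteq> C x}" using D eq by auto
      have "sym_diff (sym_diff x D) z = sym_diff (sym_diff x z) D" by auto
      then show "(- t) ^ card (sym_diff x (sym_diff x D)) * t ^ card (sym_diff (sym_diff x D) z)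
        = (- t) ^ card D * t ^ card (sym_diff (sym_diff x z) D)" using eq by simp
    qed auto
    finally show ?thesis by (simp only: sum.inter_filter[OF fB])
  qed
  have w_sum: "(\<Sum>x\<in>T. c x * w x z) = (\<Sum>y\<in>?B. \<gamma> y * t ^ card (sym_diff y z))"
    if z: "z \<subseteq> V" for z
  proof -
    have "(\<Sum>x\<in>T. c x * w x z) = (\<Sum>x\<in>T. \<Sum>y\<in>?B. (if sym_diff x y \<subseteq> C x
      then c x * (- t) ^ card (sym_diff x y) else 0) * t ^ card (sym_diff y z))"
      using w_expand z by (auto simp: sum_distrib_left intro!: sum.cong)
    also have "\<dots> = (\<Sum>y\<in>?B. \<gamma> y * t ^ card (sym_diff y z))"
      unfolding \<gamma>_def sum_distrib_right by (rule sum.swap)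
    finally show ?thesis .
  qed
  \<comment> \<open>On \<open>A\<close> this is how \<open>c\<close> was chosen; outside \<open>A\<close> every \<open>w x\<close> vanishes.\<close>
  have w_zero: "(\<Sum>x\<in>T. c x * w x z) = 0" if "z \<subseteq> V" "V - z \<in> B" for z
  proof (cases "z \<in> A")
    case True then show ?thesis using c(2) that by auto
  next
    case False
    then have "w x z = 0" if "x \<in> T" for x using A[OF that \<open>z \<subseteq> V\<close>] by (auto simp: w_def)
    then show ?thesis by simp
  qed
  have \<gamma>0: "\<gamma> y = 0" if "y \<in> ?B" for y
  proof (rule top_coefficients_force_zero[OF V _ _ that])
    fix z assume z: "z \<in> ?B"
    then have "V - (V - z) = z" by auto
    with z have "(\<Sum>x\<in>T. c x * w x (V - z)) = 0" by (intro w_zero) auto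
    then show "(\<Sum>y\<in>?B. \<gamma> y * monom 1 (card (sym_diff y (V - z)))) = 0"
      using w_sum[of "V - z"] by (simp add: tpow)
  qed simp
  have "c x = 0" if "x \<in> T" for x
  proof (rule bottom_coefficients_force_zero[OF fT _ _ that, of w])
    fix x z assume x: "x \<in> T" and z: "z \<in> T"
    have "finite x" "finite z" using V x z T by (auto intro: finite_subset)
    then have fin: "finite (sym_diff x z)" by simp
    have c0: "coeff p 0 = poly p 0" for p :: "int poly" by (simp add: poly_0_coeff_0)
    have "card (sym_diff x z) = 0 \<longleftrightarrow> x = z" using fin by auto
    then show "coeff (w x z) 0 = (if x = z then 1 else 0)"
      by (auto simp: w_def c0 t_def poly_monom zero_power)
  next
    fix z assume "z \<in> T"
    then show "(\<Sum>x\<in>T. c x * w x z) = 0" using w_sum[of z] \<gamma>0 T by auto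
  qed
  with c(1) show False by blast
qed

section \<open>Weights by the layer-cake formula\<close>

lemma layer_cake_ennreal:
  fixes u :: ennreal
  shows "(\<integral>\<^sup>+s. indicator {s. 0 \<le> s \<and> ennreal s < u} s \<partial>lborel) = u"
proof -
  have "(\<integral>\<^sup>+s. indicator {s. 0 \<le> s \<and> ennreal s < u} s \<partial>lborel)
      = emeasure lborel {s. 0 \<le> s \<and> ennreal s < u}"
    by (rule nn_integral_indicator) measurable
  also have "\<dots> = u"
  proof (cases u)
    case (real r)
    then have "{s. 0 \<le> s \<and> ennreal s < u} = {0..<r}" by (auto simp: ennreal_less_iff)
    then show ?thesis using real by simp
  next
    case top
    then have "emeasure lborel {0..real k} \<le> emeasure lborel {s. 0 \<le> s \<and> ennreal s < u}" for k
      by (intro emeasure_mono) auto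
    then have "of_nat k \<le> emeasure lborel {s. 0 \<le> s \<and> ennreal s < u}" for k
      by (simp add: ennreal_of_nat_eq_real_of_nat)
    then show ?thesis using top by (metis ennreal_Ex_less_of_nat leD top.not_eq_extremum)
  qed
  finally show ?thesis .
qed

text \<open>
  At levels \<open>s\<close> and \<open>t\<close> the left-hand side counts the \<open>x\<close> with \<open>s < a x\<close> and \<open>t < b x\<close>; for these \<open>x\<close> the
  superlevel sets of \<open>\<Phi>\<close> and \<open>\<Gamma>\<close> contain the two wings of the butterfly, so the counting theorem
  bounds this number by the right-hand side at the same levels.
\<close>

lemma weighted_butterfly:
  fixes V :: "'v set" and a b \<Phi> \<Gamma> :: "'v set \<Rightarrow> ennreal"
  assumes V: "finite V" and T: "T \<subseteq> Pow V"
    and C: "\<And>x. x \<in> T \<Longrightarrow> C x \<subseteq> V"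
    and a: "\<And>x z. x \<in> T \<Longrightarrow> z \<subseteq> V \<Longrightarrow> sym_diff x z \<inter> C x = {} \<Longrightarrow> a x \<le> \<Phi> z"
    and b: "\<And>x z. x \<in> T \<Longrightarrow> z \<subseteq> V \<Longrightarrow> sym_diff x z \<subseteq> C x \<Longrightarrow> b x \<le> \<Gamma> z"
  shows "(\<Sum>x\<in>T. a x * b x) \<le> (\<Sum>z\<in>Pow V. \<Phi> z * \<Gamma> (V - z))"
proof -
  let ?I = "\<lambda>u s. indicator {s. 0 \<le> s \<and> ennreal s < u} s :: ennreal"
  have fT: "finite T" using T V by (auto intro: finite_subset)
  have swap: "(\<Sum>x\<in>R. p x * q x) = (\<integral>\<^sup>+s. \<integral>\<^sup>+t. (\<Sum>x\<in>R. ?I (p x) s * ?I (q x) t) \<partial>lborel \<partial>lborel)"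
    if "finite R" for R :: "'v set set" and p q :: "'v set \<Rightarrow> ennreal"
  proof -
    have m: "?I w \<in> borel_measurable lborel" for w by measurable
    show ?thesis
      by (simp add: nn_integral_sum nn_integral_cmult[OF m] nn_integral_multc[OF m] layer_cake_ennreal)
  qed
  have "(\<Sum>x\<in>T. ?I (a x) s * ?I (b x) t) \<le> (\<Sum>z\<in>Pow V. ?I (\<Phi> z) s * ?I (\<Gamma> (V - z)) t)" for s t
  proof (cases "0 \<le> s \<and> 0 \<le> t")
    case True
    let ?T = "{x\<in>T. ennreal s < a x \<and> ennreal t < b x}"
    let ?A = "{z. ennreal s < \<Phi> z}" and ?B = "{z. ennreal t < \<Gamma> z}"
    have cnt: "(\<Sum>x\<in>R. ?I (p x) s * ?I (q x) t) = of_nat (card {x\<in>R. ennreal s < p x \<and> ennreal t < q x})"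
      if R: "finite R" for R :: "'v set set" and p q :: "'v set \<Rightarrow> ennreal"
    proof -
      have "(\<Sum>x\<in>R. ?I (p x) s * ?I (q x) t) = (\<Sum>x\<in>R. if ennreal s < p x \<and> ennreal t < q x then 1 else 0)"
        using True by (intro sum.cong) auto
      also have "\<dots> = (\<Sum>x\<in>{x\<in>R. ennreal s < p x \<and> ennreal t < q x}. 1)"
        by (rule sum.inter_filter[OF R, symmetric])
      finally show ?thesis by simp
    qed
    have "card ?T \<le> card {z \<in> Pow V. z \<in> ?A \<and> V - z \<in> ?B}"
    proof (rule reimer_butterfly[OF V, where C = C])
      show "?T \<subseteq> Pow V" using T by auto
      show "C x \<subseteq> V" if "x \<in> ?T" for x using C that by simp
      show "z \<in> ?A" if "x \<in> ?T" "z \<subseteq> V" "sym_diff x z \<inter> C x = {}" for x z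
        using a[of x z] that less_le_trans by blast
      show "z \<in> ?B" if "x \<in> ?T" "z \<subseteq> V" "sym_diff x z \<subseteq> C x" for x z
        using b[of x z] that less_le_trans by blast
    qed
    then show ?thesis using cnt[OF fT] cnt[of "Pow V"] V by simp
  qed auto
  then have "(\<integral>\<^sup>+s. \<integral>\<^sup>+t. (\<Sum>x\<in>T. ?I (a x) s * ?I (b x) t) \<partial>lborel \<partial>lborel)
      \<le> (\<integral>\<^sup>+s. \<integral>\<^sup>+t. (\<Sum>z\<in>Pow V. ?I (\<Phi> z) s * ?I (\<Gamma> (V - z)) t) \<partial>lborel \<partial>lborel)"
    by (intro nn_integral_mono)
  then show ?thesis
    using swap[OF fT, of a b] swap[of "Pow V" \<Phi> "\<lambda>z. \<Gamma> (V - z)"] V by simp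
qed

text \<open>
  A sum of finitely many suprema is approached by choosing an index in each term independently.
  The summand \<open>c\<close> collects the terms whose index is already chosen in the induction.
\<close>

lemma sum_SUP_le_choice:
  fixes h :: "'z \<Rightarrow> 'p \<Rightarrow> ennreal"
  assumes "finite Z" and I: "I \<noteq> {}"
    and "\<And>p. p \<in> Z \<rightarrow> I \<Longrightarrow> c + (\<Sum>z\<in>Z. h z (p z)) \<le> R"
  shows "c + (\<Sum>z\<in>Z. SUP i\<in>I. h z i) \<le> R"
  using assms(1,3)
proof (induction Z arbitrary: c rule: finite_induct)
  case empty
  then show ?case by simp
next
  case (insert z Z)
  have "c + h z i + (\<Sum>z\<in>Z. SUP i\<in>I. h z i) \<le> R" if i: "i \<in> I" for i
  proof (rule insert.IH)
    fix p assume "p \<in> Z \<rightarrow> I"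
    then have "c + (\<Sum>y\<in>insert z Z. h y ((p(z := i)) y)) \<le> R"
      using i by (intro insert.prems) auto
    moreover have "(\<Sum>y\<in>Z. h y ((p(z := i)) y)) = (\<Sum>y\<in>Z. h y (p y))"
      using insert.hyps by (intro sum.cong) auto
    ultimately show "c + h z i + (\<Sum>z\<in>Z. h z (p z)) \<le> R"
      using insert.hyps by (simp add: add.assoc)
  qed
  then have "(SUP i\<in>I. (c + (\<Sum>z\<in>Z. SUP i\<in>I. h z i)) + h z i) \<le> R"
    by (intro SUP_least) (simp add: add_ac)
  then have "c + (\<Sum>z\<in>Z. SUP i\<in>I. h z i) + (SUP i\<in>I. h z i) \<le> R"
    unfolding ennreal_SUP_add_right[OF I] .
  then show ?case using insert.hyps by (simp add: add_ac)
qed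

section \<open>Exchanging coordinates of two independent copies\<close>

text \<open>
  Here \<open>merge\<close> picks coordinates from two points of the full product rather than from points
  of the two partial products.
\<close>

lemma measurable_merge_total:
  "(\<lambda>(x, y). merge J K (x, y)) \<in> Pi\<^sub>M (J \<union> K) M \<Otimes>\<^sub>M Pi\<^sub>M (J \<union> K) M \<rightarrow>\<^sub>M Pi\<^sub>M (J \<union> K) M"
proof -
  have "(\<lambda>(x, y). merge J K (restrict x J, restrict y K))
      \<in> Pi\<^sub>M (J \<union> K) M \<Otimes>\<^sub>M Pi\<^sub>M (J \<union> K) M \<rightarrow>\<^sub>M Pi\<^sub>M (J \<union> K) M"
    unfolding case_prod_beta
    by (intro measurable_compose[OF _ measurable_merge] measurable_Pair
        measurable_compose[OF measurable_fst] measurable_compose[OF measurable_snd]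
        measurable_restrict_subset) auto
  then show ?thesis by simp
qed

text \<open>
  The first factor reads \<open>x\<close> on \<open>J\<close> and \<open>y\<close> on \<open>K\<close>, the second one \<open>y\<close> on \<open>J\<close> and \<open>x\<close> on \<open>K\<close>, so the four
  blocks of coordinates fall into two independent pairs: for independent \<open>x\<close> and \<open>y\<close> the exchanged
  pair is again a pair of independent copies.
\<close>

lemma (in product_prob_space) nn_integral_exchange_coordinates:
  fixes F G :: "('i \<Rightarrow> 'a) \<Rightarrow> ennreal"
  assumes JK: "J \<inter> K = {}" "finite J" "finite K"
    and F[measurable]: "F \<in> borel_measurable (Pi\<^sub>M (J \<union> K) M)"
    and G[measurable]: "G \<in> borel_measurable (Pi\<^sub>M (J \<union> K) M)"
  shows "(\<integral>\<^sup>+x. \<integral>\<^sup>+y. F (merge J K (x, y)) * G (merge J K (y, x)) \<partial>Pi\<^sub>M (J \<union> K) M \<partial>Pi\<^sub>M (J \<union> K) M)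
    = (\<integral>\<^sup>+x. F x \<partial>Pi\<^sub>M (J \<union> K) M) * (\<integral>\<^sup>+x. G x \<partial>Pi\<^sub>M (J \<union> K) M)"
proof -
  let ?P = "Pi\<^sub>M (J \<union> K) M" and ?m = "\<lambda>x y. merge J K (x, y)"
  interpret PP: prob_space ?P by (rule prob_space_PiM) (rule M.prob_space_axioms)
  interpret PJ: prob_space "Pi\<^sub>M J M" by (rule prob_space_PiM) (rule M.prob_space_axioms)
  interpret PK: prob_space "Pi\<^sub>M K M" by (rule prob_space_PiM) (rule M.prob_space_axioms)
  note [measurable] = measurable_merge_total[of J K M]
  have mm: "?m (?m a b) y = ?m a y" "?m x (?m a b) = ?m x b" for a b x y
    by (auto simp: merge_def fun_eq_iff)
  have G': "(\<integral>\<^sup>+b. \<integral>\<^sup>+a. G (?m a b) \<partial>Pi\<^sub>M J M \<partial>Pi\<^sub>M K M) = (\<integral>\<^sup>+x. G x \<partial>?P)"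
    using product_nn_integral_fold[of K J G] JK by (simp add: Un_commute Int_commute merge_commute)
  have inner: "(\<integral>\<^sup>+y. F (?m a y) * G (?m y b) \<partial>?P)
      = (\<integral>\<^sup>+y. F (?m a y) \<partial>Pi\<^sub>M K M) * (\<integral>\<^sup>+y. G (?m y b) \<partial>Pi\<^sub>M J M)"
    if [measurable]: "a \<in> space (Pi\<^sub>M J M)" "b \<in> space (Pi\<^sub>M K M)" for a b
  proof -
    have 1[measurable]: "(\<lambda>y. ?m a y) \<in> Pi\<^sub>M K M \<rightarrow>\<^sub>M ?P" by measurable
    have 2[measurable]: "(\<lambda>y. ?m y b) \<in> Pi\<^sub>M J M \<rightarrow>\<^sub>M ?P" by measurable
    have 3: "(\<lambda>y. restrict y K) \<in> ?P \<rightarrow>\<^sub>M Pi\<^sub>M K M" "(\<lambda>y. restrict y J) \<in> ?P \<rightarrow>\<^sub>M Pi\<^sub>M J M"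
      by (auto intro!: measurable_restrict_subset)
    have [measurable]: "(\<lambda>y. ?m a y) \<in> ?P \<rightarrow>\<^sub>M ?P" "(\<lambda>y. ?m y b) \<in> ?P \<rightarrow>\<^sub>M ?P"
      using measurable_compose[OF 3(1) 1] measurable_compose[OF 3(2) 2] by simp_all
    have "(\<integral>\<^sup>+y. F (?m a y) * G (?m y b) \<partial>?P)
        = (\<integral>\<^sup>+a'. \<integral>\<^sup>+b'. F (?m a b') * G (?m a' b) \<partial>Pi\<^sub>M K M \<partial>Pi\<^sub>M J M)"
      by (subst product_nn_integral_fold[OF JK]) (simp_all add: mm)
    also have "\<dots> = (\<integral>\<^sup>+y. F (?m a y) \<partial>Pi\<^sub>M K M) * (\<integral>\<^sup>+y. G (?m y b) \<partial>Pi\<^sub>M J M)"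
      by (simp add: nn_integral_multc nn_integral_cmult)
    finally show ?thesis .
  qed
  have "(\<integral>\<^sup>+x. \<integral>\<^sup>+y. F (?m x y) * G (?m y x) \<partial>?P \<partial>?P)
      = (\<integral>\<^sup>+a. \<integral>\<^sup>+b. (\<integral>\<^sup>+y. F (?m a y) * G (?m y b) \<partial>?P) \<partial>Pi\<^sub>M K M \<partial>Pi\<^sub>M J M)"
    by (subst product_nn_integral_fold[OF JK]) (simp_all add: mm)
  also have "\<dots> = (\<integral>\<^sup>+a. \<integral>\<^sup>+b. (\<integral>\<^sup>+y. F (?m a y) \<partial>Pi\<^sub>M K M) * (\<integral>\<^sup>+y. G (?m y b) \<partial>Pi\<^sub>M J M) \<partial>Pi\<^sub>M K M \<partial>Pi\<^sub>M J M)"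
    by (intro nn_integral_cong) (simp add: inner)
  also have "\<dots> = (\<integral>\<^sup>+a. \<integral>\<^sup>+y. F (?m a y) \<partial>Pi\<^sub>M K M \<partial>Pi\<^sub>M J M) * (\<integral>\<^sup>+b. \<integral>\<^sup>+y. G (?m y b) \<partial>Pi\<^sub>M J M \<partial>Pi\<^sub>M K M)"
    by (simp add: nn_integral_multc nn_integral_cmult)
  finally show ?thesis unfolding G' by (simp add: product_nn_integral_fold[OF JK F])
qed

section \<open>The inequality for cylinder functions\<close>

text \<open>
  Both sides are symmetrised over all \<open>2 ^ card I\<close> exchanges of coordinates between two independent copies.
  For fixed copies, choose a pair \<open>(\<alpha>, \<beta>)\<close> for each exchange \<open>z\<close> and let \<open>C z = K \<alpha>\<close>. Exchanges that
  agree with \<open>z\<close> on \<open>K \<alpha>\<close> keep the value of \<open>f \<alpha>\<close>, and those that agree with \<open>z\<close> off \<open>K \<alpha>\<close> keep the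
  value of \<open>g \<beta>\<close>, since \<open>L \<beta>\<close> lies off \<open>K \<alpha>\<close>; so the weighted counting theorem applies.
\<close>

lemma (in product_prob_space) disjoint_cylinder_product_inequality:
  fixes f :: "'x \<Rightarrow> ('i \<Rightarrow> 'a) \<Rightarrow> ennreal" and g :: "'y \<Rightarrow> ('i \<Rightarrow> 'a) \<Rightarrow> ennreal"
  assumes I: "finite I" and cA: "countable A" and cB: "countable B"
    and f: "\<And>\<alpha>. \<alpha> \<in> A \<Longrightarrow> f \<alpha> \<in> borel_measurable (Pi\<^sub>M I M)"
    and K: "\<And>\<alpha>. \<alpha> \<in> A \<Longrightarrow> K \<alpha> \<subseteq> I"
    and fK: "\<And>\<alpha>. \<alpha> \<in> A \<Longrightarrow> depends_on (space (Pi\<^sub>M I M)) (K \<alpha>) (f \<alpha>)"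
    and g: "\<And>\<beta>. \<beta> \<in> B \<Longrightarrow> g \<beta> \<in> borel_measurable (Pi\<^sub>M I M)"
    and gL: "\<And>\<beta>. \<beta> \<in> B \<Longrightarrow> depends_on (space (Pi\<^sub>M I M)) (L \<beta>) (g \<beta>)"
  shows "(\<integral>\<^sup>+x. (SUP (\<alpha>, \<beta>) \<in> {(\<alpha>, \<beta>). \<alpha> \<in> A \<and> \<beta> \<in> B \<and> K \<alpha> \<inter> L \<beta> = {}}. f \<alpha> x * g \<beta> x) \<partial>Pi\<^sub>M I M)
    \<le> (\<integral>\<^sup>+x. (SUP \<alpha>\<in>A. f \<alpha> x) \<partial>Pi\<^sub>M I M) * (\<integral>\<^sup>+x. (SUP \<beta>\<in>B. g \<beta> x) \<partial>Pi\<^sub>M I M)"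
proof -
  let ?P = "Pi\<^sub>M I M"
  define W where "W = {(\<alpha>, \<beta>). \<alpha> \<in> A \<and> \<beta> \<in> B \<and> K \<alpha> \<inter> L \<beta> = {}}"
  define H where "H x = (SUP p\<in>W. f (fst p) x * g (snd p) x)" for x
  define F where "F x = (SUP \<alpha>\<in>A. f \<alpha> x)" for x
  define G where "G x = (SUP \<beta>\<in>B. g \<beta> x)" for x
  define mix where "mix z x y = merge (I - z) z (x, y)" for z and x y :: "'i \<Rightarrow> 'a"
  interpret P: prob_space ?P by (rule prob_space_PiM) (rule M.prob_space_axioms)
  have cW: "countable W" by (rule countable_subset[of _ "A \<times> B"]) (use cA cB in \<open>auto simp: W_def\<close>)
  have [measurable]: "F \<in> borel_measurable ?P" "G \<in> borel_measurable ?P"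
    unfolding F_def G_def using f g cA cB by (auto intro!: borel_measurable_SUP)
  have [measurable]: "H \<in> borel_measurable ?P"
    unfolding H_def using f g cW by (auto intro!: borel_measurable_SUP borel_measurable_times simp: W_def)
  have mix_meas: "(\<lambda>p. mix z (fst p) (snd p)) \<in> ?P \<Otimes>\<^sub>M ?P \<rightarrow>\<^sub>M ?P" if "z \<subseteq> I" for z
  proof -
    have "I - z \<union> z = I" using that by auto
    then show ?thesis
      using measurable_merge_total[of "I - z" z M] by (simp add: case_prod_beta mix_def)
  qed
  have mix_space: "mix z x y \<in> space ?P" if "z \<subseteq> I" "x \<in> space ?P" "y \<in> space ?P" for z x y
    using measurable_space[OF mix_meas[OF that(1)], of "(x, y)"] that by (simp add: space_pair_measure)
  have mix_compl: "mix (I - z) x y = mix z y x" if "z \<subseteq> I" for x y z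
    using that by (auto simp: mix_def merge_def fun_eq_iff)
  have pointwise: "(\<Sum>z\<in>Pow I. H (mix z x y)) \<le> (\<Sum>z\<in>Pow I. F (mix z x y) * G (mix z y x))"
    if x: "x \<in> space ?P" and y: "y \<in> space ?P" for x y
  proof (cases "W = {}")
    case True then show ?thesis by (simp add: H_def bot_ennreal)
  next
    case False
    have "0 + (\<Sum>z\<in>Pow I. SUP p\<in>W. f (fst p) (mix z x y) * g (snd p) (mix z x y))
      \<le> (\<Sum>z\<in>Pow I. F (mix z x y) * G (mix (I - z) x y))"
    proof (rule sum_SUP_le_choice[OF _ False])
      fix p assume p: "p \<in> Pow I \<rightarrow> W"
      have pz: "fst (p z) \<in> A" "snd (p z) \<in> B" "K (fst (p z)) \<inter> L (snd (p z)) = {}"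
        if "z \<in> Pow I" for z using p that by (auto simp: W_def Pi_iff split_beta)
      have agree: "h (mix z x y) = h (mix z' x y)"
        if "z \<subseteq> I" "z' \<subseteq> I" "sym_diff z z' \<inter> Q = {}" "depends_on (space ?P) Q h"
        for z z' Q and h :: "_ \<Rightarrow> ennreal"
      proof -
        have "restrict (mix z x y) Q = restrict (mix z' x y) Q"
          using that(1-3) by (auto simp: mix_def merge_def restrict_def fun_eq_iff)
        then show ?thesis using that mix_space x y unfolding depends_on_def by blast
      qed
      have "(\<Sum>z\<in>Pow I. f (fst (p z)) (mix z x y) * g (snd (p z)) (mix z x y))
        \<le> (\<Sum>z\<in>Pow I. F (mix z x y) * G (mix (I - z) x y))"
      proof (rule weighted_butterfly[OF I order.refl, where C = "\<lambda>z. K (fst (p z))"])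
        fix z assume "z \<in> Pow I"
        then show "K (fst (p z)) \<subseteq> I" using K pz by blast
      next
        fix z z' assume z: "z \<in> Pow I" and z': "z' \<subseteq> I" and a: "sym_diff z z' \<inter> K (fst (p z)) = {}"
        have "f (fst (p z)) (mix z x y) = f (fst (p z)) (mix z' x y)"
          using agree[OF _ z' a fK] z pz by blast
        also have "\<dots> \<le> F (mix z' x y)" unfolding F_def by (intro SUP_upper pz z)
        finally show "f (fst (p z)) (mix z x y) \<le> F (mix z' x y)" .
      next
        fix z z' assume z: "z \<in> Pow I" and z': "z' \<subseteq> I" and a: "sym_diff z z' \<subseteq> K (fst (p z))"
        have a': "sym_diff z z' \<inter> L (snd (p z)) = {}" using a pz[OF z] by blast
        have "g (snd (p z)) (mix z x y) = g (snd (p z)) (mix z' x y)"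
          using agree[OF _ z' a' gL] z pz by blast
        also have "\<dots> \<le> G (mix z' x y)" unfolding G_def by (intro SUP_upper pz z)
        finally show "g (snd (p z)) (mix z x y) \<le> G (mix z' x y)" .
      qed
      then show "0 + (\<Sum>z\<in>Pow I. f (fst (p z)) (mix z x y) * g (snd (p z)) (mix z x y))
        \<le> (\<Sum>z\<in>Pow I. F (mix z x y) * G (mix (I - z) x y))" by simp
    qed (use I in simp)
    then show ?thesis by (simp add: H_def mix_compl)
  qed
  have exchange: "(\<integral>\<^sup>+x. \<integral>\<^sup>+y. u (mix z x y) * v (mix z y x) \<partial>?P \<partial>?P) = (\<integral>\<^sup>+x. u x \<partial>?P) * (\<integral>\<^sup>+x. v x \<partial>?P)"
    if "z \<subseteq> I" "u \<in> borel_measurable ?P" "v \<in> borel_measurable ?P" for z and u v :: "_ \<Rightarrow> ennreal"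
  proof -
    have "I - z \<union> z = I" "(I - z) \<inter> z = {}" "finite z" "finite (I - z)"
      using that(1) I finite_subset by auto
    then show ?thesis
      using nn_integral_exchange_coordinates[of "I - z" z u v] that by (simp add: mix_def)
  qed
  have meas: "(\<lambda>p. u (mix z (fst p) (snd p))) \<in> borel_measurable (?P \<Otimes>\<^sub>M ?P)"
    "(\<lambda>p. u (mix z (snd p) (fst p))) \<in> borel_measurable (?P \<Otimes>\<^sub>M ?P)"
    if "z \<subseteq> I" "u \<in> borel_measurable ?P" for z and u :: "_ \<Rightarrow> ennreal"
  proof -
    show "(\<lambda>p. u (mix z (fst p) (snd p))) \<in> borel_measurable (?P \<Otimes>\<^sub>M ?P)"
      using measurable_compose[OF mix_meas that(2)] that(1) by simp
    then have *: "(\<lambda>p. u (mix z (fst p) (snd p))) \<in> borel_measurable (?P \<Otimes>\<^sub>M ?P)" .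
    have "(\<lambda>p. (snd p, fst p)) \<in> ?P \<Otimes>\<^sub>M ?P \<rightarrow>\<^sub>M ?P \<Otimes>\<^sub>M ?P" by measurable
    from measurable_compose[OF this *]
    show "(\<lambda>p. u (mix z (snd p) (fst p))) \<in> borel_measurable (?P \<Otimes>\<^sub>M ?P)" by simp
  qed
  \<comment> \<open>By the exchange identity each of the \<open>2 ^ card I\<close> terms has the same integral.\<close>
  have sumswap: "(\<integral>\<^sup>+x. \<integral>\<^sup>+y. (\<Sum>z\<in>Pow I. u (mix z x y) * v (mix z y x)) \<partial>?P \<partial>?P)
      = of_nat (card (Pow I)) * ((\<integral>\<^sup>+x. u x \<partial>?P) * (\<integral>\<^sup>+x. v x \<partial>?P))"
    if u: "u \<in> borel_measurable ?P" and v: "v \<in> borel_measurable ?P" for u v :: "_ \<Rightarrow> ennreal"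
  proof -
    have m: "(\<lambda>p. u (mix z (fst p) (snd p)) * v (mix z (snd p) (fst p))) \<in> borel_measurable (?P \<Otimes>\<^sub>M ?P)"
      if "z \<in> Pow I" for z using meas[OF _ u] meas[OF _ v] that by auto
    have m1: "(\<lambda>y. u (mix z x y) * v (mix z y x)) \<in> borel_measurable ?P"
      if "z \<in> Pow I" "x \<in> space ?P" for z x
      using measurable_compose[OF measurable_Pair1'[OF that(2)] m[OF that(1)]] by simp
    have m2: "(\<lambda>x. \<integral>\<^sup>+y. u (mix z x y) * v (mix z y x) \<partial>?P) \<in> borel_measurable ?P"
      if "z \<in> Pow I" for z
      using P.borel_measurable_nn_integral_fst[OF m[OF that]] by simp
    have "(\<integral>\<^sup>+x. \<integral>\<^sup>+y. (\<Sum>z\<in>Pow I. u (mix z x y) * v (mix z y x)) \<partial>?P \<partial>?P)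
        = (\<integral>\<^sup>+x. (\<Sum>z\<in>Pow I. \<integral>\<^sup>+y. u (mix z x y) * v (mix z y x) \<partial>?P) \<partial>?P)"
      by (intro nn_integral_cong nn_integral_sum m1)
    also have "\<dots> = (\<Sum>z\<in>Pow I. \<integral>\<^sup>+x. \<integral>\<^sup>+y. u (mix z x y) * v (mix z y x) \<partial>?P \<partial>?P)"
      by (intro nn_integral_sum m2)
    also have "\<dots> = (\<Sum>z\<in>Pow I. (\<integral>\<^sup>+x. u x \<partial>?P) * (\<integral>\<^sup>+x. v x \<partial>?P))"
      by (intro sum.cong refl exchange) (use u v in auto)
    finally show ?thesis by simp
  qed
  have "of_nat (card (Pow I)) * (\<integral>\<^sup>+x. H x \<partial>?P)
      = (\<integral>\<^sup>+x. \<integral>\<^sup>+y. (\<Sum>z\<in>Pow I. H (mix z x y)) \<partial>?P \<partial>?P)"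
    \<comment> \<open>The second factor is constant, so this also says that each exchanged vector has the original law.\<close>
    using sumswap[of H "\<lambda>_. 1"] by (simp add: P.emeasure_space_1)
  also have "\<dots> \<le> (\<integral>\<^sup>+x. \<integral>\<^sup>+y. (\<Sum>z\<in>Pow I. F (mix z x y) * G (mix z y x)) \<partial>?P \<partial>?P)"
    by (intro nn_integral_mono pointwise)
  also have "\<dots> = of_nat (card (Pow I)) * ((\<integral>\<^sup>+x. F x \<partial>?P) * (\<integral>\<^sup>+x. G x \<partial>?P))"
    by (rule sumswap) measurable
  finally have "(\<integral>\<^sup>+x. H x \<partial>?P) \<le> (\<integral>\<^sup>+x. F x \<partial>?P) * (\<integral>\<^sup>+x. G x \<partial>?P)"
    by (subst (asm) ennreal_mult_le_mult_iff) (use I in \<open>auto simp del: card_Pow\<close>)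
  then show ?thesis by (simp add: H_def F_def G_def W_def case_prod_beta')
qed

section \<open>Essential infima over fibres\<close>

text \<open>
  A version of the essential infimum of \<open>f\<close> over the fibre through \<open>x\<close>. Restricting the competing
  lower bounds to rationals keeps the supremum countable, which makes it measurable in \<open>x\<close>
  and lets null sets be collected. The default \<open>0\<close> for a rational that is not a lower bound leaves
  the supremum unchanged, since \<open>ennreal\<close> sends the negative rationals to \<open>0\<close> as well.
\<close>

definition lower_envelope ::
    "('i \<Rightarrow> 'a measure) \<Rightarrow> 'i set \<Rightarrow> (('i \<Rightarrow> 'a) \<Rightarrow> real) \<Rightarrow> 'i set \<Rightarrow> ('i \<Rightarrow> 'a) \<Rightarrow> ennreal" where
  "lower_envelope M I f K x =
     (SUP q::rat. if AE y in Pi\<^sub>M (I - K) M. real_of_rat q \<le> f (merge K (I - K) (x, y))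
       then ennreal (real_of_rat q) else 0)"

lemma ess_inf_le_lower_envelope:
  "ess_inf (Pi\<^sub>M (I - K) M) (\<lambda>y. ennreal (f (merge K (I - K) (x, y)))) \<le> lower_envelope M I f K x"
  unfolding ess_inf_def
proof (rule Sup_least, rule dense_le)
  fix c d assume "c \<in> {c. AE y in Pi\<^sub>M (I - K) M. c \<le> ennreal (f (merge K (I - K) (x, y)))}"
  then have c: "AE y in Pi\<^sub>M (I - K) M. c \<le> ennreal (f (merge K (I - K) (x, y)))" by simp
  assume "d < c"
  then obtain q :: rat where q: "d < ennreal (real_of_rat q)" "ennreal (real_of_rat q) < c"
    using ennreal_rat_dense by blast
  have pos: "0 < real_of_rat q" using q(1) by (metis ennreal_eq_0_iff not_less not_less_zero)
  have "AE y in Pi\<^sub>M (I - K) M. real_of_rat q \<le> f (merge K (I - K) (x, y))"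
  proof (rule eventually_mono[OF c])
    fix y assume "c \<le> ennreal (f (merge K (I - K) (x, y)))"
    then have "ennreal (real_of_rat q) < ennreal (f (merge K (I - K) (x, y)))"
      using q(2) by (rule less_le_trans[rotated])
    then show "real_of_rat q \<le> f (merge K (I - K) (x, y))"
      using pos by (simp add: ennreal_less_iff)
  qed
  then have "ennreal (real_of_rat q) \<le> lower_envelope M I f K x"
    unfolding lower_envelope_def by (intro SUP_upper2[of q]) auto
  with q show "d \<le> lower_envelope M I f K x" by simp
qed

lemma depends_on_lower_envelope:
  fixes M :: "'i \<Rightarrow> 'a measure"
  shows "depends_on D K (lower_envelope M I f K)"
  unfolding depends_on_def
proof (intro ballI impI)
  fix x y :: "'i \<Rightarrow> 'a" assume "restrict x K = restrict y K"
  then have "merge K (I - K) (x, z) = merge K (I - K) (y, z)" for z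
    by (metis merge_restrict(1))
  then show "lower_envelope M I f K x = lower_envelope M I f K y"
    by (simp add: lower_envelope_def)
qed

context product_prob_space
begin

text \<open>
  The exceptional set of the fibre is null exactly if the integral of its indicator is zero, and
  this integral is measurable in the base point.
\<close>

lemma measurable_AE_fiber:
  assumes "K \<subseteq> I" and f: "f \<in> borel_measurable (Pi\<^sub>M I M)"
  shows "Measurable.pred (Pi\<^sub>M I M) (\<lambda>x. AE y in Pi\<^sub>M (I - K) M. (q::real) \<le> f (merge K (I - K) (x, y)))"
proof -
  interpret N: prob_space "Pi\<^sub>M (I - K) M" by (rule prob_space_PiM) (rule M.prob_space_axioms)
  have IK: "K \<union> (I - K) = I" using assms by auto
  have "(\<lambda>p. merge K (I - K) (restrict (fst p) K, snd p)) \<in> Pi\<^sub>M I M \<Otimes>\<^sub>M Pi\<^sub>M (I - K) M \<rightarrow>\<^sub>M Pi\<^sub>M (K \<union> (I - K)) M"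
    by (intro measurable_compose[OF _ measurable_merge] measurable_Pair
        measurable_compose[OF measurable_fst] measurable_snd
        measurable_restrict_subset assms)
  then have [measurable]: "(\<lambda>p. f (merge K (I - K) p)) \<in> borel_measurable (Pi\<^sub>M I M \<Otimes>\<^sub>M Pi\<^sub>M (I - K) M)"
    using measurable_compose f IK by fastforce
  have *: "(AE y in Pi\<^sub>M (I - K) M. q \<le> f (merge K (I - K) (x, y)))
      \<longleftrightarrow> (\<integral>\<^sup>+y. (if q \<le> f (merge K (I - K) (x, y)) then 0 else 1) \<partial>Pi\<^sub>M (I - K) M) = (0::ennreal)"
    if [measurable]: "x \<in> space (Pi\<^sub>M I M)" for x
    by (subst nn_integral_0_iff_AE) auto
  have "Measurable.pred (Pi\<^sub>M I M)
      (\<lambda>x. (\<integral>\<^sup>+y. (if q \<le> f (merge K (I - K) (x, y)) then 0 else 1) \<partial>Pi\<^sub>M (I - K) M) = (0::ennreal))"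
    by measurable
  then show ?thesis by (simp add: * cong: measurable_cong)
qed

lemma borel_measurable_lower_envelope:
  assumes "K \<subseteq> I" and f: "f \<in> borel_measurable (Pi\<^sub>M I M)"
  shows "lower_envelope M I f K \<in> borel_measurable (Pi\<^sub>M I M)"
proof -
  note [measurable] = measurable_AE_fiber[OF assms]
  show ?thesis unfolding lower_envelope_def by measurable
qed

text \<open>
  For a rational \<open>q\<close>, the points where \<open>f < q\<close> although \<open>q\<close> is an almost sure lower bound on the fibre
  form a set with null fibres, hence a null set by Fubini's theorem.
\<close>

lemma AE_lower_envelope_le:
  assumes I: "finite I" and KI: "K \<subseteq> I" and f: "f \<in> borel_measurable (Pi\<^sub>M I M)"
  shows "AE x in Pi\<^sub>M I M. lower_envelope M I f K x \<le> ennreal (f x)"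
proof -
  let ?J = "I - K"
  let ?Q = "\<lambda>q x. AE y in Pi\<^sub>M ?J M. real_of_rat q \<le> f (merge K ?J (x, y))"
  note [measurable] = f measurable_AE_fiber[OF KI f]
  have IK: "K \<union> ?J = I" "K \<inter> ?J = {}" "finite K" "finite ?J" using I KI finite_subset by auto
  have mm: "merge K ?J (merge K ?J (a, b), y) = merge K ?J (a, y)" for a b y
    by (auto simp: merge_def fun_eq_iff)
  have "AE x in Pi\<^sub>M I M. \<not> (?Q q x \<and> f x < real_of_rat q)" for q
  proof -
    let ?E = "{x\<in>space (Pi\<^sub>M I M). ?Q q x \<and> f x < real_of_rat q}"
    have E: "?E \<in> sets (Pi\<^sub>M I M)" by measurable
    have "emeasure (Pi\<^sub>M I M) ?E = (\<integral>\<^sup>+x. indicator ?E x \<partial>Pi\<^sub>M I M)"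
      using E by simp
    also have "\<dots> = (\<integral>\<^sup>+a. \<integral>\<^sup>+b. indicator ?E (merge K ?J (a, b)) \<partial>Pi\<^sub>M ?J M \<partial>Pi\<^sub>M K M)"
      using product_nn_integral_fold[OF IK(2-4), of "indicator ?E"] E unfolding IK(1) by simp
    also have "\<dots> = (\<integral>\<^sup>+a. 0 \<partial>Pi\<^sub>M K M)"
    proof (rule nn_integral_cong)
      fix a
      have "AE b in Pi\<^sub>M ?J M. indicator ?E (merge K ?J (a, b)) = (0::ennreal)"
      proof (cases "?Q q a")
        case True
        then show ?thesis by (rule eventually_mono) (auto simp: indicator_def)
      next
        case False
        then show ?thesis by (intro always_eventually) (simp add: indicator_def mm)
      qed
      then have "(\<integral>\<^sup>+b. indicator ?E (merge K ?J (a, b)) \<partial>Pi\<^sub>M ?J M) = (\<integral>\<^sup>+b. 0 \<partial>Pi\<^sub>M ?J M)"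
        by (rule nn_integral_cong_AE)
      then show "(\<integral>\<^sup>+b. indicator ?E (merge K ?J (a, b)) \<partial>Pi\<^sub>M ?J M) = 0" by simp
    qed
    finally have "emeasure (Pi\<^sub>M I M) ?E = 0" by simp
    then show ?thesis using AE_iff_measurable[OF E, of "\<lambda>x. \<not> (?Q q x \<and> f x < real_of_rat q)"] by simp
  qed
  then have "AE x in Pi\<^sub>M I M. \<forall>q. \<not> (?Q q x \<and> f x < real_of_rat q)"
    by (simp add: AE_all_countable)
  then show ?thesis
    unfolding lower_envelope_def
    by (rule eventually_mono) (rule SUP_least, auto intro!: ennreal_leI simp: not_less)
qed

lemma nn_integral_SUP_lower_envelope_le:
  assumes I: "finite I" and KI: "\<K> \<subseteq> Pow I" and f: "f \<in> borel_measurable (Pi\<^sub>M I M)"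
  shows "(\<integral>\<^sup>+x. (SUP K\<in>\<K>. lower_envelope M I f K x) \<partial>Pi\<^sub>M I M) \<le> (\<integral>\<^sup>+x. ennreal (f x) \<partial>Pi\<^sub>M I M)"
proof (rule nn_integral_mono_AE)
  have "finite \<K>" using I KI by (meson finite_Pow_iff finite_subset)
  then have "AE x in Pi\<^sub>M I M. \<forall>K\<in>\<K>. lower_envelope M I f K x \<le> ennreal (f x)"
    using AE_lower_envelope_le[OF I _ f] KI by (subst AE_finite_all) auto
  then show "AE x in Pi\<^sub>M I M. (SUP K\<in>\<K>. lower_envelope M I f K x) \<le> ennreal (f x)"
    by (rule eventually_mono) (auto intro: SUP_least)
qed

lemma lower_envelope_product_inequality:
  assumes I: "finite I" and KI: "\<K> \<subseteq> Pow I" "\<L> \<subseteq> Pow I"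
    and f: "f \<in> borel_measurable (Pi\<^sub>M I M)" and g: "g \<in> borel_measurable (Pi\<^sub>M I M)"
  shows "(\<integral>\<^sup>+x. (SUP (K, L) \<in> {(K, L). K \<in> \<K> \<and> L \<in> \<L> \<and> K \<inter> L = {}}.
           lower_envelope M I f K x * lower_envelope M I g L x) \<partial>Pi\<^sub>M I M)
    \<le> (\<integral>\<^sup>+x. ennreal (f x) \<partial>Pi\<^sub>M I M) * (\<integral>\<^sup>+x. ennreal (g x) \<partial>Pi\<^sub>M I M)"
proof (rule order.trans[OF disjoint_cylinder_product_inequality[OF I]])
  have "finite \<K>" "finite \<L>" using I KI by (meson finite_Pow_iff finite_subset)+
  then show "countable \<K>" "countable \<L>" by (auto intro: countable_finite)
  show "lower_envelope M I f K \<in> borel_measurable (Pi\<^sub>M I M)" if "K \<in> \<K>" for K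
    using that KI f by (intro borel_measurable_lower_envelope) auto
  show "lower_envelope M I g L \<in> borel_measurable (Pi\<^sub>M I M)" if "L \<in> \<L>" for L
    using that KI g by (intro borel_measurable_lower_envelope) auto
  show "(\<integral>\<^sup>+x. (SUP K\<in>\<K>. lower_envelope M I f K x) \<partial>Pi\<^sub>M I M)
      * (\<integral>\<^sup>+x. (SUP L\<in>\<L>. lower_envelope M I g L x) \<partial>Pi\<^sub>M I M)
    \<le> (\<integral>\<^sup>+x. ennreal (f x) \<partial>Pi\<^sub>M I M) * (\<integral>\<^sup>+x. ennreal (g x) \<partial>Pi\<^sub>M I M)"
    by (intro mult_mono nn_integral_SUP_lower_envelope_le I KI f g) auto
qed (use KI in \<open>auto intro: depends_on_lower_envelope\<close>)

end

section \<open>Independent coordinates and the joint law\<close>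

text \<open>
  The marginals are only given for indices in \<open>I\<close>, while a family of probability spaces is indexed
  by the whole type; the other indices repeat one of the marginals.
\<close>

lemma (in prob_space) indep_vars_imp_distr_eq_product:
  assumes I: "finite I" "I \<noteq> {}" and X: "X \<in> M \<rightarrow>\<^sub>M Pi\<^sub>M I S"
    and indep: "indep_vars S (\<lambda>i \<omega>. X \<omega> i) I"
  obtains N where "product_prob_space N" "\<And>i. i \<in> I \<Longrightarrow> sets (N i) = sets (S i)"
    "distr M (Pi\<^sub>M I S) X = Pi\<^sub>M I N"
proof -
  obtain j where j: "j \<in> I" using I by blast
  define r where "r i = (if i \<in> I then i else j)" for i
  define N where "N i = distr M (S (r i)) (\<lambda>\<omega>. X \<omega> (r i))" for i
  have r: "r i \<in> I" for i using j by (simp add: r_def)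
  have comp: "(\<lambda>\<omega>. X \<omega> i) \<in> M \<rightarrow>\<^sub>M S i" if "i \<in> I" for i
    using measurable_compose[OF X measurable_component_singleton[OF that]] .
  have N: "prob_space (N i)" for i
    unfolding N_def by (rule prob_space_distr) (rule comp[OF r])
  have "product_prob_space N"
    by (simp add: N product_prob_space_def product_prob_space_axioms_def product_sigma_finite_def
        prob_space_imp_sigma_finite)
  moreover have "sets (N i) = sets (S i)" if "i \<in> I" for i
    using that by (simp add: N_def r_def)
  moreover have "distr M (Pi\<^sub>M I S) X = Pi\<^sub>M I N"
  proof -
    have "distr M (Pi\<^sub>M I S) X = distr M (Pi\<^sub>M I S) (\<lambda>\<omega>. \<lambda>i\<in>I. X \<omega> i)"
    proof (rule distr_cong)
      fix \<omega> assume "\<omega> \<in> space M"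
      then have "X \<omega> \<in> extensional I" using measurable_space[OF X] by (auto simp: space_PiM PiE_def)
      then show "X \<omega> = (\<lambda>i\<in>I. X \<omega> i)" by (simp add: extensional_restrict)
    qed simp_all
    also have "\<dots> = (\<Pi>\<^sub>M i\<in>I. distr M (S i) (\<lambda>\<omega>. X \<omega> i))"
      using indep indep_vars_iff_distr_eq_PiM'[of I "\<lambda>i \<omega>. X \<omega> i" S, OF I(2) comp] by blast
    also have "\<dots> = Pi\<^sub>M I N" by (rule PiM_cong) (simp_all add: N_def r_def)
    finally show ?thesis .
  qed
  ultimately show ?thesis by (rule that)
qed

section \<open>The functional inequalities\<close>

theorem theorem1p2:
  fixes n :: nat
    and S :: "nat \<Rightarrow> 'a measure"
    and \<Omega> :: "'w measure"
    and X :: "'w \<Rightarrow> nat \<Rightarrow> 'a"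
    and P :: "(nat \<Rightarrow> 'a) measure"
  assumes "n \<ge> 1"
    and "prob_space \<Omega>"
    and "X \<in> \<Omega> \<rightarrow>\<^sub>M Pi\<^sub>M {1..n} S"
    and "P = distr \<Omega> (Pi\<^sub>M {1..n} S) X"
    and "prob_space.indep_vars \<Omega> S (\<lambda>i \<omega>. X \<omega> i) {1..n}"
  shows
    "(\<forall>(A :: 'i set) (B :: 'j set)
        (f :: 'i \<Rightarrow> (nat \<Rightarrow> 'a) \<Rightarrow> real) (g :: 'j \<Rightarrow> (nat \<Rightarrow> 'a) \<Rightarrow> real)
        (K :: 'i \<Rightarrow> nat set) (L :: 'j \<Rightarrow> nat set).
        countable A \<longrightarrow> countable B \<longrightarrow>
        (\<forall>\<alpha>\<in>A. f \<alpha> \<in> borel_measurable (Pi\<^sub>M {1..n} S) \<and>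
           (\<forall>x\<in>space (Pi\<^sub>M {1..n} S). 0 \<le> f \<alpha> x) \<and>
           K \<alpha> \<subseteq> {1..n} \<and> depends_on (space (Pi\<^sub>M {1..n} S)) (K \<alpha>) (f \<alpha>)) \<longrightarrow>
        (\<forall>\<beta>\<in>B. g \<beta> \<in> borel_measurable (Pi\<^sub>M {1..n} S) \<and>
           (\<forall>x\<in>space (Pi\<^sub>M {1..n} S). 0 \<le> g \<beta> x) \<and>
           L \<beta> \<subseteq> {1..n} \<and> depends_on (space (Pi\<^sub>M {1..n} S)) (L \<beta>) (g \<beta>)) \<longrightarrow>
        (\<integral>\<^sup>+\<omega>. (SUP (\<alpha>, \<beta>) \<in> {(\<alpha>, \<beta>). \<alpha> \<in> A \<and> \<beta> \<in> B \<and> K \<alpha> \<inter> L \<beta> = {}}.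
                  ennreal (f \<alpha> (X \<omega>) * g \<beta> (X \<omega>))) \<partial>\<Omega>)
          \<le> (\<integral>\<^sup>+\<omega>. (SUP \<alpha>\<in>A. ennreal (f \<alpha> (X \<omega>))) \<partial>\<Omega>) *
             (\<integral>\<^sup>+\<omega>. (SUP \<beta>\<in>B. ennreal (g \<beta> (X \<omega>))) \<partial>\<Omega>))
     \<and>
     (\<forall>(f :: (nat \<Rightarrow> 'a) \<Rightarrow> real) (g :: (nat \<Rightarrow> 'a) \<Rightarrow> real)
        (\<K> :: nat set set) (\<L> :: nat set set).
        f \<in> borel_measurable (Pi\<^sub>M {1..n} S) \<longrightarrow> (\<forall>x\<in>space (Pi\<^sub>M {1..n} S). 0 \<le> f x) \<longrightarrow>
        g \<in> borel_measurable (Pi\<^sub>M {1..n} S) \<longrightarrow> (\<forall>x\<in>space (Pi\<^sub>M {1..n} S). 0 \<le> g x) \<longrightarrow>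
        \<K> \<subseteq> Pow {1..n} \<longrightarrow> \<L> \<subseteq> Pow {1..n} \<longrightarrow>
        (\<integral>\<^sup>+\<omega>. (SUP (K, L) \<in> {(K, L). K \<in> \<K> \<and> L \<in> \<L> \<and> K \<inter> L = {}}.
                  ess_inf_cyl S {1..n} P f K (X \<omega>) * ess_inf_cyl S {1..n} P g L (X \<omega>)) \<partial>\<Omega>)
          \<le> (\<integral>\<^sup>+\<omega>. ennreal (f (X \<omega>)) \<partial>\<Omega>) * (\<integral>\<^sup>+\<omega>. ennreal (g (X \<omega>)) \<partial>\<Omega>))"
proof (intro conjI allI impI, goal_cases)
  interpret \<Omega>: prob_space \<Omega> by fact
  let ?I = "{1..n}"
  have I: "finite ?I" "?I \<noteq> {}" using assms(1) by auto
  obtain N where N: "product_prob_space N" and sN: "\<And>i. i \<in> ?I \<Longrightarrow> sets (N i) = sets (S i)"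
    and PN: "distr \<Omega> (Pi\<^sub>M ?I S) X = Pi\<^sub>M ?I N"
    using \<Omega>.indep_vars_imp_distr_eq_product[OF I assms(3,5)] by metis
  interpret N: product_prob_space N ?I by fact
  have sets: "sets (Pi\<^sub>M J S) = sets (Pi\<^sub>M J N)" if "J \<subseteq> ?I" for J
    using that by (intro sets_PiM_cong refl) (auto simp: sN)
  have space: "space (Pi\<^sub>M ?I S) = space (Pi\<^sub>M ?I N)" by (intro sets_eq_imp_space_eq sets) simp
  have bor: "borel_measurable (Pi\<^sub>M ?I S) = borel_measurable (Pi\<^sub>M ?I N)"
    by (intro measurable_cong_sets sets) auto
  have law: "(\<integral>\<^sup>+\<omega>. \<phi> (X \<omega>) \<partial>\<Omega>) = (\<integral>\<^sup>+x. \<phi> x \<partial>Pi\<^sub>M ?I N)"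
    if "\<phi> \<in> borel_measurable (Pi\<^sub>M ?I N)" for \<phi> :: "_ \<Rightarrow> ennreal"
    using nn_integral_distr[OF assms(3), of \<phi>] that unfolding bor PN by simp
  have Xsp: "X \<omega> \<in> space (Pi\<^sub>M ?I S)" if "\<omega> \<in> space \<Omega>" for \<omega>
    using measurable_space[OF assms(3) that] .
  {
    case (1 A B f g K L)
    let ?W = "{(\<alpha>, \<beta>). \<alpha> \<in> A \<and> \<beta> \<in> B \<and> K \<alpha> \<inter> L \<beta> = {}}"
    have W: "countable ?W" by (rule countable_subset[of _ "A \<times> B"]) (use 1 in auto)
    have f: "(\<lambda>x. ennreal (f \<alpha> x)) \<in> borel_measurable (Pi\<^sub>M ?I N)" if "\<alpha> \<in> A" for \<alpha>
      using 1 that bor by auto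
    have g: "(\<lambda>x. ennreal (g \<beta> x)) \<in> borel_measurable (Pi\<^sub>M ?I N)" if "\<beta> \<in> B" for \<beta>
      using 1 that bor by auto
    have H: "(\<lambda>x. SUP (\<alpha>, \<beta>) \<in> ?W. ennreal (f \<alpha> x) * ennreal (g \<beta> x)) \<in> borel_measurable (Pi\<^sub>M ?I N)"
      using W unfolding case_prod_beta
      by (intro borel_measurable_SUP borel_measurable_times_ennreal f g) auto
    have "(\<integral>\<^sup>+\<omega>. (SUP (\<alpha>, \<beta>) \<in> ?W. ennreal (f \<alpha> (X \<omega>) * g \<beta> (X \<omega>))) \<partial>\<Omega>)
        = (\<integral>\<^sup>+\<omega>. (SUP (\<alpha>, \<beta>) \<in> ?W. ennreal (f \<alpha> (X \<omega>)) * ennreal (g \<beta> (X \<omega>))) \<partial>\<Omega>)"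
      using 1 Xsp by (intro nn_integral_cong SUP_cong refl) (auto simp: ennreal_mult)
    also have "\<dots> = (\<integral>\<^sup>+x. (SUP (\<alpha>, \<beta>) \<in> ?W. ennreal (f \<alpha> x) * ennreal (g \<beta> x)) \<partial>Pi\<^sub>M ?I N)"
      by (rule law[OF H])
    also have "\<dots> \<le> (\<integral>\<^sup>+x. (SUP \<alpha>\<in>A. ennreal (f \<alpha> x)) \<partial>Pi\<^sub>M ?I N)
        * (\<integral>\<^sup>+x. (SUP \<beta>\<in>B. ennreal (g \<beta> x)) \<partial>Pi\<^sub>M ?I N)"
    proof (rule N.disjoint_cylinder_product_inequality[where f = "\<lambda>\<alpha> x. ennreal (f \<alpha> x)"
          and g = "\<lambda>\<beta> x. ennreal (g \<beta> x)"])
      fix \<alpha> assume "\<alpha> \<in> A"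
      with 1 show "K \<alpha> \<subseteq> ?I" "depends_on (space (Pi\<^sub>M ?I N)) (K \<alpha>) (\<lambda>x. ennreal (f \<alpha> x))"
        unfolding depends_on_def space by (blast, metis)
    next
      fix \<beta> assume "\<beta> \<in> B"
      with 1 show "depends_on (space (Pi\<^sub>M ?I N)) (L \<beta>) (\<lambda>x. ennreal (g \<beta> x))"
        unfolding depends_on_def space by metis
    qed (use 1 f g in auto)
    also have "\<dots> = (\<integral>\<^sup>+\<omega>. (SUP \<alpha>\<in>A. ennreal (f \<alpha> (X \<omega>))) \<partial>\<Omega>) * (\<integral>\<^sup>+\<omega>. (SUP \<beta>\<in>B. ennreal (g \<beta> (X \<omega>))) \<partial>\<Omega>)"
      using 1 f g by (subst (1 2) law) (auto intro!: borel_measurable_SUP)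
    finally show ?case .
  next
    case (2 f g \<K> \<L>)
    let ?W = "{(K, L). K \<in> \<K> \<and> L \<in> \<L> \<and> K \<inter> L = {}}"
    have f: "f \<in> borel_measurable (Pi\<^sub>M ?I N)" and g: "g \<in> borel_measurable (Pi\<^sub>M ?I N)"
      using 2 bor by auto
    have W: "countable ?W"
    proof (rule countable_finite, rule finite_subset)
      show "?W \<subseteq> Pow ?I \<times> Pow ?I" using 2 by blast
    qed simp
    have marg: "marginal S (?I - K) P = Pi\<^sub>M (?I - K) N" for K
    proof -
      have "marginal S (?I - K) P = distr (Pi\<^sub>M ?I N) (Pi\<^sub>M (?I - K) N) (\<lambda>x. restrict x (?I - K))"
        unfolding marginal_def assms(4) PN by (intro distr_cong refl sets) auto
      then show ?thesis using N.distr_restrict[of "?I - K" ?I] by simp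
    qed
    have le: "ess_inf_cyl S ?I P h K x \<le> lower_envelope N ?I h K x" for h K x
      unfolding ess_inf_cyl_def marg by (rule ess_inf_le_lower_envelope)
    have H: "(\<lambda>x. SUP (K, L) \<in> ?W. lower_envelope N ?I f K x * lower_envelope N ?I g L x)
        \<in> borel_measurable (Pi\<^sub>M ?I N)"
      using W unfolding case_prod_beta
      by (intro borel_measurable_SUP borel_measurable_times_ennreal
          N.borel_measurable_lower_envelope f g) (use 2 in auto)
    have "(\<integral>\<^sup>+\<omega>. (SUP (K, L) \<in> ?W. ess_inf_cyl S ?I P f K (X \<omega>) * ess_inf_cyl S ?I P g L (X \<omega>)) \<partial>\<Omega>)
        \<le> (\<integral>\<^sup>+\<omega>. (SUP (K, L) \<in> ?W. lower_envelope N ?I f K (X \<omega>) * lower_envelope N ?I g L (X \<omega>)) \<partial>\<Omega>)"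
      unfolding case_prod_beta by (intro nn_integral_mono SUP_mono' mult_mono le) auto
    also have "\<dots> = (\<integral>\<^sup>+x. (SUP (K, L) \<in> ?W. lower_envelope N ?I f K x * lower_envelope N ?I g L x) \<partial>Pi\<^sub>M ?I N)"
      by (rule law[OF H])
    also have "\<dots> \<le> (\<integral>\<^sup>+x. ennreal (f x) \<partial>Pi\<^sub>M ?I N) * (\<integral>\<^sup>+x. ennreal (g x) \<partial>Pi\<^sub>M ?I N)"
      using 2 by (intro N.lower_envelope_product_inequality f g) auto
    also have "\<dots> = (\<integral>\<^sup>+\<omega>. ennreal (f (X \<omega>)) \<partial>\<Omega>) * (\<integral>\<^sup>+\<omega>. ennreal (g (X \<omega>)) \<partial>\<Omega>)"
      using f g by (subst (1 2) law) auto
    finally show ?case .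
  }
qed

end
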